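(* Let $\mathcal{H}$ be a Hilbert space, let $\{f_k\}_{k=1}^\infty$ be a frame sequence in $\mathcal{H}$ with bounds $A,B$, and let $\{g_k\}_{k=1}^\infty$ be a dual frame sequence of $\{f_k\}_{k=1}^\infty$ with bounds $C,D$. Let $\{h_k\}_{k=1}^\infty$ be a sequence in $\mathcal{H}$ and put $K:=\overline{\mathrm{span}}\{h_k\}_{k=1}^\infty$ and $L:=\overline{\mathrm{span}}\{f_k\}_{k=1}^\infty$. Assume that $\delta(K,L)<1$. If $\{h_k\}_{k=1}^\infty$ satisfies the following two conditions: (1) $\lambda:=\sum_{k=1}^\infty\|f_k-h_k\|^2<\infty$; (2) $\mu:=\sum_{k=1}^\infty\|f_k-h_k\|\,\|g_k\|<1$, then $\{h_k\}_{k=1}^\infty$ is a frame sequence with bounds $\frac{1}{D}(1-\mu)^2$ and $B\left(1+\frac{\sqrt{\lambda}}{\sqrt{B}}\right)^2\frac{1}{(1-\delta(K,L))^2}$. Moreover, the restriction to $K$ of the orthogonal projection $P_L$ of $\mathcal{H}$ onto $L$ is an isomorphism from $K$ onto $L$.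
   Context: A sequence $\{f_k\}_{k=1}^\infty$ in a Hilbert space $\mathcal{H}$ is a frame sequence with bounds $A,B$ (where $A,B>0$; $A$ lower, $B$ upper) if it is a frame with these bounds for its closed linear span $L=\overline{\mathrm{span}}\{f_k\}_{k=1}^\infty$, i.e. $A\|f\|^2\le\sum_{k=1}^\infty|\langle f,f_k\rangle|^2\le B\|f\|^2$ for all $f\in L$. A dual frame sequence of $\{f_k\}_{k=1}^\infty$ with bounds $C,D$ is a dual frame of $\{f_k\}_{k=1}^\infty$ in the Hilbert space $L$: a sequence $\{g_k\}_{k=1}^\infty$ in $L$ which is a frame for $L$ with bounds $C,D$ and satisfies $f=\sum_{k=1}^\infty\langle f,g_k\rangle f_k$ for all $f\in L$. For subspaces $K,L$ of $\mathcal{H}$ the gap from $K$ to $L$ is $\delta(K,L):=\sup_{x\in K,\|x\|=1}\inf_{y\in L}\|x-y\|$ if $K\ne\{0\}$, and $\delta(K,L):=0$ if $K=\{0\}$. Isomorphism means a bounded linear bijection with bounded inverse. *)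

theory Defs
  imports "HOL-Analysis.Analysis"
begin

text \<open>
  Scalars of a Hilbert space. The library's inner product spaces are real only; this class
  has \<^typ>\<open>real\<close> and \<^typ>\<open>complex\<close> as instances and, by Mazur's theorem on normed fields,
  no others up to isometric isomorphism.
\<close>

class hilbert_scalar = real_normed_field +
  fixes conjg :: "'a \<Rightarrow> 'a"
  assumes conjg_add: "conjg (a + b) = conjg a + conjg b"
    and conjg_mult: "conjg (a * b) = conjg a * conjg b"
    and conjg_conjg: "conjg (conjg a) = a"
    and mult_conjg: "a * conjg a = (norm a)\<^sup>2 *\<^sub>R 1"

instantiation real :: hilbert_scalar
begin
definition conjg_real :: "real \<Rightarrow> real" where "conjg_real a = a"
instance by standard (simp_all add: conjg_real_def power2_eq_square)
end

instantiation complex :: hilbert_scalar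
begin
definition conjg_complex :: "complex \<Rightarrow> complex" where "conjg_complex a = cnj a"
instance by standard
    (simp_all add: conjg_complex_def complex_norm_square scaleR_conv_of_real del: of_real_power)
end

text \<open>
  The carrier is a whole type. Its norm, topology and completeness come from the class
  \<^class>\<open>banach\<close>; the inner product (linear in the first argument) induces that norm.
\<close>

locale hilbert_space = vector_space smul
  for smul :: "'k::hilbert_scalar \<Rightarrow> 'a::banach \<Rightarrow> 'a" +
  fixes ip :: "'a \<Rightarrow> 'a \<Rightarrow> 'k"
  assumes smul_of_real: "smul (of_real r) x = r *\<^sub>R x"
    and ip_add_left: "ip (x + y) z = ip x z + ip y z"
    and ip_smul_left: "ip (smul a x) y = a * ip x y"
    and ip_commute: "ip x y = conjg (ip y x)"
    and ip_self: "ip x x = of_real ((norm x)\<^sup>2)"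

lemma hilbert_space_real:
  "hilbert_space scaleR (inner :: 'a::{real_inner,banach} \<Rightarrow> 'a \<Rightarrow> real)"
  by unfold_locales
    (simp_all add: inner_add_left inner_add_right conjg_real_def inner_commute power2_norm_eq_inner
      scaleR_add_left scaleR_add_right)

lemma hilbert_space_complex:
  "hilbert_space (*) (\<lambda>x y :: complex. x * cnj y)"
  by unfold_locales
    (simp_all add: algebra_simps conjg_complex_def scaleR_conv_of_real complex_norm_square
      del: of_real_power)

definition closed_span ::
    "('k::comm_ring_1 \<Rightarrow> 'a \<Rightarrow> 'a) \<Rightarrow> (nat \<Rightarrow> 'a) \<Rightarrow> 'a::real_normed_vector set" where
  "closed_span smul f = closure (module.span smul (range f))"

definition frame_for ::
    "('a \<Rightarrow> 'a \<Rightarrow> 'k::real_normed_field) \<Rightarrow> 'a::real_normed_vector set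
      \<Rightarrow> (nat \<Rightarrow> 'a) \<Rightarrow> real \<Rightarrow> real \<Rightarrow> bool" where
  "frame_for ip M f A B \<longleftrightarrow> 0 < A \<and> 0 < B \<and> range f \<subseteq> M \<and>
    (\<forall>x\<in>M. summable (\<lambda>k. (norm (ip x (f k)))\<^sup>2) \<and>
      A * (norm x)\<^sup>2 \<le> (\<Sum>k. (norm (ip x (f k)))\<^sup>2) \<and>
      (\<Sum>k. (norm (ip x (f k)))\<^sup>2) \<le> B * (norm x)\<^sup>2)"

definition frame_sequence ::
    "('k::real_normed_field \<Rightarrow> 'a \<Rightarrow> 'a) \<Rightarrow> ('a \<Rightarrow> 'a \<Rightarrow> 'k)
      \<Rightarrow> (nat \<Rightarrow> 'a::real_normed_vector) \<Rightarrow> real \<Rightarrow> real \<Rightarrow> bool" where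
  "frame_sequence smul ip f A B \<longleftrightarrow> frame_for ip (closed_span smul f) f A B"

text \<open>In \<open>dual_frame_sequence smul ip f g C D\<close>, it is \<open>g\<close> that is a dual of \<open>f\<close>.\<close>

definition dual_frame_sequence ::
    "('k::real_normed_field \<Rightarrow> 'a \<Rightarrow> 'a) \<Rightarrow> ('a \<Rightarrow> 'a \<Rightarrow> 'k)
      \<Rightarrow> (nat \<Rightarrow> 'a::real_normed_vector) \<Rightarrow> (nat \<Rightarrow> 'a) \<Rightarrow> real \<Rightarrow> real \<Rightarrow> bool" where
  "dual_frame_sequence smul ip f g C D \<longleftrightarrow>
    frame_for ip (closed_span smul f) g C D \<and>
    (\<forall>x\<in>closed_span smul f. (\<lambda>k. smul (ip x (g k)) (f k)) sums x)"

definition gap :: "'a::real_normed_vector set \<Rightarrow> 'a set \<Rightarrow> real" where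
  "gap K L = (if K = {0} then 0 else (SUP x\<in>{x\<in>K. norm x = 1}. INF y\<in>L. norm (x - y)))"

definition orth_proj ::
    "('a \<Rightarrow> 'a \<Rightarrow> 'k::zero) \<Rightarrow> 'a::ab_group_add set \<Rightarrow> 'a \<Rightarrow> 'a" where
  "orth_proj ip M x = (THE y. y \<in> M \<and> (\<forall>z\<in>M. ip (x - y) z = 0))"

text \<open>Only the values of \<open>T\<close> on \<open>K\<close> matter: this is a property of the restriction of \<open>T\<close> to \<open>K\<close>.\<close>

definition isomorphism_on ::
    "('k \<Rightarrow> 'a \<Rightarrow> 'a) \<Rightarrow> 'a::real_normed_vector set \<Rightarrow> 'a set \<Rightarrow> ('a \<Rightarrow> 'a) \<Rightarrow> bool" where
  "isomorphism_on smul K L T \<longleftrightarrow>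
    (\<forall>x\<in>K. \<forall>y\<in>K. T (x + y) = T x + T y) \<and>
    (\<forall>a. \<forall>x\<in>K. T (smul a x) = smul a (T x)) \<and>
    (\<exists>M. \<forall>x\<in>K. norm (T x) \<le> M * norm x) \<and>
    bij_betw T K L \<and>
    (\<exists>M. \<forall>y\<in>L. norm (inv_into K T y) \<le> M * norm y)"

end

(*
  Put V x = sum_k <x, g_k> h_k for x in L. Since x = sum_k <x, g_k> f_k, Cauchy-Schwarz gives
  |x - V x| <= mu |x|, so P_L V is invertible on L and P_L maps K onto L. As |x - P_L x| <= gap K L |x|
  on K, P_L is also injective on K with bounded inverse, whence V maps L onto K. The lower frame bound
  follows from |V x|^2 = sum_k conj <x, g_k> <V x, h_k> by Cauchy-Schwarz in l^2 and
  (1 - mu) |x| <= |V x|. The upper bound is the triangle inequality in l^2; even without the factor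
  1 / (1 - gap K L)^2, which is at least 1, it holds.
*)

theory Submission
  imports Defs
begin

section \<open>Square-summable sequences\<close>

text \<open>Minkowski's inequality in l^2. A uniform bound on the finite sums gives summability and
  the estimate together. The numbers \<open>s\<close> and \<open>t\<close> are upper bounds rather
  than norms because frame inequalities supply them in that form.\<close>

lemma suminf_square_triangle:
  fixes a b :: "nat \<Rightarrow> real"
  assumes "summable (\<lambda>k. (a k)\<^sup>2)" "summable (\<lambda>k. (b k)\<^sup>2)"
    and "(\<Sum>k. (a k)\<^sup>2) \<le> s\<^sup>2" "(\<Sum>k. (b k)\<^sup>2) \<le> t\<^sup>2" "0 \<le> s" "0 \<le> t"
  shows "summable (\<lambda>k. (a k + b k)\<^sup>2)" "(\<Sum>k. (a k + b k)\<^sup>2) \<le> (s + t)\<^sup>2"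
proof -
  have le: "(\<Sum>k<n. (a k + b k)\<^sup>2) \<le> (s + t)\<^sup>2" for n
  proof -
    have "(\<Sum>k<n. (a k)\<^sup>2) \<le> s\<^sup>2" "(\<Sum>k<n. (b k)\<^sup>2) \<le> t\<^sup>2"
      using assms sum_le_suminf[of "\<lambda>k. (a k)\<^sup>2" "{..<n}"] sum_le_suminf[of "\<lambda>k. (b k)\<^sup>2" "{..<n}"]
      by auto
    then have "L2_set a {..<n} \<le> s" "L2_set b {..<n} \<le> t"
      unfolding L2_set_def using assms(5,6) by (auto intro: real_le_lsqrt sum_nonneg)
    then have "L2_set (\<lambda>k. a k + b k) {..<n} \<le> s + t"
      using L2_set_triangle_ineq[of a b "{..<n}"] by linarith
    then show ?thesis
      unfolding L2_set_def by (rule sqrt_le_D)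
  qed
  show sm: "summable (\<lambda>k. (a k + b k)\<^sup>2)"
    by (rule summableI_nonneg_bounded[OF _ le]) simp
  show "(\<Sum>k. (a k + b k)\<^sup>2) \<le> (s + t)\<^sup>2"
    by (rule suminf_le_const[OF sm le])
qed

text \<open>Cauchy-Schwarz in l^2, first for partial sums and then in the limit. No conjugate occurs
  here; it is to be put into one of the two factors.\<close>

lemma norm_sums_mult_le:
  fixes a b :: "nat \<Rightarrow> 'k::real_normed_field"
  assumes "summable (\<lambda>k. (norm (a k))\<^sup>2)" "summable (\<lambda>k. (norm (b k))\<^sup>2)"
    and "(\<lambda>k. a k * b k) sums s"
  shows "norm s \<le> sqrt (\<Sum>k. (norm (a k))\<^sup>2) * sqrt (\<Sum>k. (norm (b k))\<^sup>2)"
proof -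
  have "norm (\<Sum>k<n. a k * b k) \<le> sqrt (\<Sum>k. (norm (a k))\<^sup>2) * sqrt (\<Sum>k. (norm (b k))\<^sup>2)" for n
  proof -
    have "norm (\<Sum>k<n. a k * b k) \<le> (\<Sum>k<n. \<bar>norm (a k)\<bar> * \<bar>norm (b k)\<bar>)"
      by (rule order_trans[OF norm_sum]) (simp add: norm_mult)
    also have "\<dots> \<le> L2_set (\<lambda>k. norm (a k)) {..<n} * L2_set (\<lambda>k. norm (b k)) {..<n}"
      by (rule L2_set_mult_ineq)
    also have "\<dots> \<le> sqrt (\<Sum>k. (norm (a k))\<^sup>2) * sqrt (\<Sum>k. (norm (b k))\<^sup>2)"
      unfolding L2_set_def
      by (intro mult_mono real_sqrt_le_mono sum_le_suminf assms real_sqrt_ge_zero suminf_nonneg sum_nonneg)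
        auto
    finally show ?thesis .
  qed
  moreover have "(\<lambda>n. norm (\<Sum>k<n. a k * b k)) \<longlonglongrightarrow> norm s"
    using assms(3) unfolding sums_def by (rule tendsto_norm)
  ultimately show ?thesis
    by (intro Lim_bounded) auto
qed

section \<open>Conjugation of scalars\<close>

lemma conjg_0 [simp]: "conjg (0::'k::hilbert_scalar) = 0"
  using conjg_add[of 0 "0::'k"] by simp

text \<open>The class does not postulate this. At a real scalar \<open>mult_conjg\<close> gives the
  square of \<open>r\<close> on the right, and a nonzero \<open>r\<close> cancels.\<close>

lemma conjg_of_real [simp]: "conjg (of_real r :: 'k::hilbert_scalar) = of_real r"
proof (cases "r = 0")
  case False
  have "of_real r * conjg (of_real r :: 'k) = of_real r * of_real r"
    using mult_conjg[of "of_real r :: 'k"] by (simp add: power2_eq_square scaleR_conv_of_real)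
  with False show ?thesis by simp
qed simp

lemma norm_conjg [simp]: "norm (conjg a) = norm (a::'k::hilbert_scalar)"
proof (cases "a = 0")
  case False
  have "norm a * norm (conjg a) = norm a * norm a"
    using arg_cong[OF mult_conjg[of a], of norm] by (simp add: norm_mult power2_eq_square)
  with False show ?thesis by simp
qed simp

section \<open>Inner product geometry\<close>

context hilbert_space
begin

lemma ip_add_right: "ip x (y + z) = ip x y + ip x z"
  using ip_commute[of x "y + z"] ip_commute[of x y] ip_commute[of x z]
  by (simp add: ip_add_left conjg_add)

lemma ip_smul_right: "ip x (smul a y) = conjg a * ip x y"
  using ip_commute[of x "smul a y"] ip_commute[of x y] by (simp add: ip_smul_left conjg_mult)

lemma ip_0_left [simp]: "ip 0 y = 0"
  using ip_add_left[of 0 0 y] by simp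

lemma ip_0_right [simp]: "ip y 0 = 0"
  using ip_add_right[of y 0 0] by simp

lemma ip_diff_left: "ip (x - y) z = ip x z - ip y z"
  using ip_add_left[of "x - y" y z] by simp

lemma ip_diff_right: "ip x (y - z) = ip x y - ip x z"
  using ip_add_right[of x "y - z" z] by simp

lemma ip_eq_0_commute: "ip x y = 0 \<longleftrightarrow> ip y x = 0"
  by (metis conjg_0 ip_commute)

lemma ip_self_eq_0 [simp]: "ip x x = 0 \<longleftrightarrow> x = 0"
  by (simp add: ip_self)

text \<open>For scalars that are not real, the axioms link \<open>smul\<close> to the norm only
  through \<open>ip_self\<close>, so homogeneity comes from expanding
  \<open>ip (smul a x) (smul a x)\<close>.\<close>

lemma norm_smul: "norm (smul a x) = norm a * norm x"
proof -
  have "of_real ((norm (smul a x))\<^sup>2) = (of_real ((norm a * norm x)\<^sup>2) :: 'k)"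
  proof -
    have "of_real ((norm (smul a x))\<^sup>2) = ip (smul a x) (smul a x)"
      by (simp only: ip_self)
    also have "\<dots> = (a * conjg a) * ip x x"
      by (simp add: ip_smul_left ip_smul_right)
    also have "\<dots> = of_real ((norm a * norm x)\<^sup>2)"
      by (simp add: mult_conjg ip_self scaleR_conv_of_real power_mult_distrib)
    finally show ?thesis .
  qed
  then have "(norm (smul a x))\<^sup>2 = (norm a * norm x)\<^sup>2"
    by (simp only: of_real_eq_iff)
  then show ?thesis by simp
qed

lemma pythagoras:
  assumes "ip x y = 0"
  shows "(norm (x + y))\<^sup>2 = (norm x)\<^sup>2 + (norm y)\<^sup>2"
proof -
  have "ip y x = 0" using assms ip_eq_0_commute by blast
  then have "ip (x + y) (x + y) = ip x x + ip y y"
    using assms by (simp add: ip_add_left ip_add_right)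
  then have "of_real ((norm (x + y))\<^sup>2) = (of_real ((norm x)\<^sup>2 + (norm y)\<^sup>2) :: 'k)"
    by (simp only: ip_self of_real_add)
  then show ?thesis by (simp only: of_real_eq_iff)
qed

text \<open>Removing from \<open>x\<close> its component along \<open>y\<close> leaves a vector
  orthogonal to \<open>y\<close>, so Pythagoras applies. Nonnegativity of the left side yields
  \<open>Cauchy_Schwarz\<close>; the strict drop in norm later shows that the residual of a nearest
  point is orthogonal to the subspace.\<close>

lemma norm_residual_square:
  assumes "y \<noteq> 0"
  shows "(norm (x - smul (ip x y / of_real ((norm y)\<^sup>2)) y))\<^sup>2
    = (norm x)\<^sup>2 - (norm (ip x y))\<^sup>2 / (norm y)\<^sup>2"
proof -
  define c where "c = ip x y / of_real ((norm y)\<^sup>2)"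
  have "ip (x - smul c y) y = 0"
    using assms by (simp add: ip_diff_left ip_smul_left ip_self c_def)
  then have "ip (x - smul c y) (smul c y) = 0"
    by (simp add: ip_smul_right)
  from pythagoras[OF this] have "(norm x)\<^sup>2 = (norm (x - smul c y))\<^sup>2 + (norm c * norm y)\<^sup>2"
    by (simp add: norm_smul)
  moreover have "norm c = norm (ip x y) / (norm y)\<^sup>2"
    by (simp add: c_def norm_divide norm_power)
  then have "(norm c * norm y)\<^sup>2 = (norm (ip x y))\<^sup>2 / (norm y)\<^sup>2"
    using assms by (simp add: power2_eq_square)
  ultimately show ?thesis by (simp add: c_def)
qed

lemma Cauchy_Schwarz: "norm (ip x y) \<le> norm x * norm y"
proof (cases "y = 0")
  case False
  then have "(norm (ip x y))\<^sup>2 / (norm y)\<^sup>2 \<le> (norm x)\<^sup>2"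
    using norm_residual_square[OF False, of x]
      zero_le_power2[of "norm (x - smul (ip x y / of_real ((norm y)\<^sup>2)) y)"] by linarith
  then have "(norm (ip x y))\<^sup>2 \<le> (norm x * norm y)\<^sup>2"
    using False by (simp add: divide_le_eq power_mult_distrib)
  then show ?thesis by (rule power2_le_imp_le) simp
qed simp

lemma bounded_bilinear_ip: "bounded_bilinear ip"
proof
  show "ip (r *\<^sub>R x) y = r *\<^sub>R ip x y" for r x y
    using ip_smul_left[of "of_real r" x y] by (simp add: smul_of_real scaleR_conv_of_real)
  show "ip x (r *\<^sub>R y) = r *\<^sub>R ip x y" for r x y
    using ip_smul_right[of x "of_real r" y] by (simp add: smul_of_real scaleR_conv_of_real)
  show "\<exists>M. \<forall>x y. norm (ip x y) \<le> norm x * norm y * M"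
    by (rule exI[of _ 1]) (simp add: Cauchy_Schwarz)
qed (simp_all add: ip_add_left ip_add_right)

lemma bounded_bilinear_smul: "bounded_bilinear smul"
proof
  show "smul (r *\<^sub>R a) x = r *\<^sub>R smul a x" for r a x
    by (metis scale_scale scaleR_conv_of_real smul_of_real)
  show "smul a (r *\<^sub>R x) = r *\<^sub>R smul a x" for r a x
    by (metis scale_left_commute smul_of_real)
  show "\<exists>M. \<forall>a x. norm (smul a x) \<le> norm a * norm x * M"
    by (rule exI[of _ 1]) (simp add: norm_smul)
qed (simp_all add: scale_left_distrib scale_right_distrib)

lemma parallelogram:
  fixes x y :: 'a
  shows "(norm (x + y))\<^sup>2 + (norm (x - y))\<^sup>2 = 2 * (norm x)\<^sup>2 + 2 * (norm y)\<^sup>2"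
proof -
  have "ip (x + y) (x + y) + ip (x - y) (x - y) = 2 * ip x x + 2 * ip y y"
    by (simp add: ip_add_left ip_add_right ip_diff_left ip_diff_right)
  then have "of_real ((norm (x + y))\<^sup>2 + (norm (x - y))\<^sup>2)
      = (of_real (2 * (norm x)\<^sup>2 + 2 * (norm y)\<^sup>2) :: 'k)"
    by (simp add: ip_self)
  then show ?thesis by (simp only: of_real_eq_iff)
qed

section \<open>Subspaces and closed spans\<close>

lemma subspace_scaleR: "subspace M \<Longrightarrow> x \<in> M \<Longrightarrow> r *\<^sub>R x \<in> M"
  by (metis smul_of_real subspace_scale)

lemma closed_subspace_closed_span: "subspace (closed_span smul f)" "closed (closed_span smul f)"
proof -
  let ?S = "module.span smul (range f)"
  have S: "subspace ?S" by (rule subspace_span)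
  show "subspace (closed_span smul f)"
    unfolding closed_span_def
  proof (rule subspaceI)
    show "0 \<in> closure ?S"
      using subspace_0[OF S] closure_subset by blast
  next
    fix x y assume "x \<in> closure ?S" "y \<in> closure ?S"
    then obtain u v where uv: "\<And>n. u n \<in> ?S" "u \<longlonglongrightarrow> x" "\<And>n. v n \<in> ?S" "v \<longlonglongrightarrow> y"
      by (auto simp: closure_sequential)
    have "\<And>n. u n + v n \<in> ?S" "(\<lambda>n. u n + v n) \<longlonglongrightarrow> x + y"
      using uv by (auto intro: subspace_add[OF S] tendsto_add)
    then show "x + y \<in> closure ?S"
      unfolding closure_sequential by (intro exI[of _ "\<lambda>n. u n + v n"]) auto
  next
    fix a x assume "x \<in> closure ?S"
    then obtain u where u: "\<And>n. u n \<in> ?S" "u \<longlonglongrightarrow> x"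
      by (auto simp: closure_sequential)
    have "\<And>n. smul a (u n) \<in> ?S" "(\<lambda>n. smul a (u n)) \<longlonglongrightarrow> smul a x"
      using u by (auto intro: subspace_scale[OF S] bounded_bilinear.tendsto[OF bounded_bilinear_smul])
    then show "smul a x \<in> closure ?S"
      unfolding closure_sequential by (intro exI[of _ "\<lambda>n. smul a (u n)"]) auto
  qed
  show "closed (closed_span smul f)" by (simp add: closed_span_def)
qed

lemma closed_span_base: "f k \<in> closed_span smul f"
  unfolding closed_span_def using span_base[of "f k" "range f"] closure_subset by blast

text \<open>This places the values of the operator \<open>V\<close> in \<open>K\<close>: partial
  sums lie in the span, and the closure keeps their limit.\<close>

lemma sums_in_closed_span:
  assumes "(\<lambda>k. smul (c k) (f k)) sums s"
  shows "s \<in> closed_span smul f"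
proof (rule closed_sequentially[OF closed_subspace_closed_span(2)])
  show "(\<Sum>k<n. smul (c k) (f k)) \<in> closed_span smul f" for n
    by (intro subspace_sum[OF closed_subspace_closed_span(1)]
        subspace_scale[OF closed_subspace_closed_span(1)] closed_span_base)
qed (use assms in \<open>simp add: sums_def\<close>)

section \<open>Orthogonal projection onto a closed subspace\<close>

text \<open>A minimising sequence is Cauchy by the parallelogram law, and completeness together with
  closedness of \<open>M\<close> provides its limit.\<close>

lemma nearest_point_exists:
  assumes M: "subspace M" "closed M"
  shows "\<exists>y\<in>M. \<forall>z\<in>M. norm (x - y) \<le> norm (x - z)"
proof -
  have ne: "M \<noteq> {}" using subspace_0[OF M(1)] by blast
  define d where "d = infdist x M"
  have d0: "0 \<le> d" by (simp add: d_def infdist_nonneg)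
  have dle: "d \<le> norm (x - z)" if "z \<in> M" for z
    using infdist_le[OF that, of x] by (simp add: d_def dist_norm)
  \<comment> \<open>The error is measured on squared distances, so that it enters the parallelogram
    law directly.\<close>
  have "\<exists>y\<in>M. (norm (x - y))\<^sup>2 < d\<^sup>2 + inverse (real (Suc n))" for n
  proof -
    have "d < sqrt (d\<^sup>2 + inverse (real (Suc n)))"
      using d0 by (intro real_less_rsqrt) simp
    then obtain y where y: "y \<in> M" "dist x y < sqrt (d\<^sup>2 + inverse (real (Suc n)))"
      unfolding d_def infdist_notempty[OF ne] using cInf_lessD[of "dist x ` M"] ne by auto
    have "(dist x y)\<^sup>2 < (sqrt (d\<^sup>2 + inverse (real (Suc n))))\<^sup>2"
      by (rule power_strict_mono[OF y(2)]) auto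
    also have "\<dots> = d\<^sup>2 + inverse (real (Suc n))"
      by (rule real_sqrt_pow2) (simp add: add_nonneg_nonneg)
    finally show ?thesis
      using y(1) by (auto simp: dist_norm)
  qed
  then obtain y where y: "\<And>n. y n \<in> M" "\<And>n. (norm (x - y n))\<^sup>2 < d\<^sup>2 + inverse (real (Suc n))"
    by metis
  have close: "(norm (y m - y n))\<^sup>2 \<le> 2 * inverse (real (Suc m)) + 2 * inverse (real (Suc n))" for m n
  proof -
    \<comment> \<open>The midpoint stays in \<open>M\<close>, hence is at distance at least
      \<open>d\<close> from \<open>x\<close>; this caps the difference term in the parallelogram
      law.\<close>
    let ?w = "(1/2) *\<^sub>R (y m + y n)"
    have "?w \<in> M" by (intro subspace_scaleR subspace_add M y)
    then have "d\<^sup>2 \<le> (norm (x - ?w))\<^sup>2" using dle d0 by (intro power_mono)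
    moreover have "(x - y m) + (x - y n) = 2 *\<^sub>R (x - ?w)"
      by (simp add: algebra_simps scaleR_2)
    then have "(norm ((x - y m) + (x - y n)))\<^sup>2 = 4 * (norm (x - ?w))\<^sup>2"
      by (simp add: power_mult_distrib)
    moreover have "(norm ((x - y m) - (x - y n)))\<^sup>2 = (norm (y m - y n))\<^sup>2"
      by (simp add: norm_minus_commute)
    ultimately show ?thesis
      using parallelogram[of "x - y m" "x - y n"] y(2)[of m] y(2)[of n] by linarith
  qed
  have "Cauchy y"
  proof (rule CauchyI)
    fix e :: real assume e: "0 < e"
    \<comment> \<open>The two terms in \<open>close\<close> carry a factor 2 each, so a quarter of
      the square of \<open>e\<close> for each inverse suffices.\<close>
    then obtain N where N: "inverse (real (Suc N)) < e\<^sup>2 / 4"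
      using reals_Archimedean[of "e\<^sup>2 / 4"] by auto
    have small: "inverse (real (Suc n)) < e\<^sup>2 / 4" if "N \<le> n" for n
    proof -
      have "inverse (real (Suc n)) \<le> inverse (real (Suc N))"
        using that by (intro le_imp_inverse_le) auto
      then show ?thesis using N by linarith
    qed
    have "norm (y m - y n) < e" if "N \<le> m" "N \<le> n" for m n
    proof (rule power2_less_imp_less)
      show "(norm (y m - y n))\<^sup>2 < e\<^sup>2"
        using close[of m n] small[OF that(1)] small[OF that(2)] by linarith
    qed (use e in simp)
    then show "\<exists>N. \<forall>m\<ge>N. \<forall>n\<ge>N. norm (y m - y n) < e" by blast
  qed
  then obtain l where l: "y \<longlonglongrightarrow> l"
    using Cauchy_convergent convergent_def by blast
  have "l \<in> M" by (rule closed_sequentially[OF M(2) y(1) l])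
  moreover have "norm (x - l) \<le> d"
  proof (rule power2_le_imp_le[OF _ d0])
    have "(\<lambda>n. (norm (x - y n))\<^sup>2) \<longlonglongrightarrow> (norm (x - l))\<^sup>2"
      by (intro tendsto_intros l)
    moreover have "(\<lambda>n. d\<^sup>2 + inverse (real (Suc n))) \<longlonglongrightarrow> d\<^sup>2 + 0"
      by (intro tendsto_intros LIMSEQ_inverse_real_of_nat)
    ultimately have "(norm (x - l))\<^sup>2 \<le> d\<^sup>2 + 0"
      by (rule LIMSEQ_le) (use y(2) less_imp_le in blast)
    then show "(norm (x - l))\<^sup>2 \<le> d\<^sup>2" by simp
  qed
  ultimately show ?thesis using dle order_trans by blast
qed

text \<open>The working rule for the definite description: the difference of two candidates lies in
  \<open>M\<close> and is orthogonal to itself, hence zero.\<close>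

lemma orth_proj_eqI:
  assumes "subspace M" "y \<in> M" "\<And>z. z \<in> M \<Longrightarrow> ip (x - y) z = 0"
  shows "orth_proj ip M x = y"
  unfolding orth_proj_def
proof (rule the_equality)
  fix u assume u: "u \<in> M \<and> (\<forall>z\<in>M. ip (x - u) z = 0)"
  have "u - y \<in> M" using u assms subspace_diff by blast
  then have "ip (x - y) (u - y) - ip (x - u) (u - y) = 0" using u assms by simp
  then have "ip (u - y) (u - y) = 0" by (simp add: ip_diff_left)
  then show "u = y" by simp
qed (use assms in blast)

text \<open>The nearest point qualifies: if its residual had a component along some \<open>z\<close>
  in \<open>M\<close>, moving by that component would bring the point strictly closer to
  \<open>x\<close>.\<close>

lemma orth_proj:
  assumes M: "subspace M" "closed M"
  shows orth_proj_in: "orth_proj ip M x \<in> M"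
    and orth_proj_orthogonal: "z \<in> M \<Longrightarrow> ip (x - orth_proj ip M x) z = 0"
proof -
  obtain y where y: "y \<in> M" "\<And>z. z \<in> M \<Longrightarrow> norm (x - y) \<le> norm (x - z)"
    using nearest_point_exists[OF M] by blast
  have ort: "ip (x - y) z = 0" if z: "z \<in> M" for z
  proof (rule ccontr)
    assume nz: "ip (x - y) z \<noteq> 0"
    then have "z \<noteq> 0" by auto
    define c where "c = ip (x - y) z / of_real ((norm z)\<^sup>2)"
    have "y + smul c z \<in> M" using y z M by (intro subspace_add subspace_scale)
    then have "norm (x - y) \<le> norm (x - y - smul c z)"
      using y(2) by (metis diff_diff_eq)
    then have "(norm (x - y))\<^sup>2 \<le> (norm (x - y - smul c z))\<^sup>2" by (rule power_mono) simp
    also have "\<dots> = (norm (x - y))\<^sup>2 - (norm (ip (x - y) z))\<^sup>2 / (norm z)\<^sup>2"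
      unfolding c_def by (rule norm_residual_square[OF \<open>z \<noteq> 0\<close>])
    also have "\<dots> < (norm (x - y))\<^sup>2" using nz \<open>z \<noteq> 0\<close> by simp
    finally show False by simp
  qed
  have eq: "orth_proj ip M x = y" by (rule orth_proj_eqI[OF M(1) y(1) ort])
  show "orth_proj ip M x \<in> M" using eq y by simp
  show "z \<in> M \<Longrightarrow> ip (x - orth_proj ip M x) z = 0" using eq ort by simp
qed

lemma orth_proj_add:
  assumes "subspace M" "closed M"
  shows "orth_proj ip M (x + y) = orth_proj ip M x + orth_proj ip M y"
proof (rule orth_proj_eqI[OF assms(1)])
  show "orth_proj ip M x + orth_proj ip M y \<in> M"
    using assms by (simp add: orth_proj_in subspace_add)
  fix z assume "z \<in> M"
  then show "ip (x + y - (orth_proj ip M x + orth_proj ip M y)) z = 0"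
    using orth_proj_orthogonal[OF assms, of z x] orth_proj_orthogonal[OF assms, of z y]
    by (simp add: ip_diff_left ip_add_left)
qed

lemma orth_proj_smul:
  assumes "subspace M" "closed M"
  shows "orth_proj ip M (smul a x) = smul a (orth_proj ip M x)"
proof (rule orth_proj_eqI[OF assms(1)])
  show "smul a (orth_proj ip M x) \<in> M"
    using assms by (simp add: orth_proj_in subspace_scale)
  fix z assume "z \<in> M"
  then show "ip (smul a x - smul a (orth_proj ip M x)) z = 0"
    using orth_proj_orthogonal[OF assms, of z x]
    by (simp add: ip_diff_left ip_smul_left)
qed

lemma orth_proj_diff:
  assumes "subspace M" "closed M"
  shows "orth_proj ip M (x - y) = orth_proj ip M x - orth_proj ip M y"
  using orth_proj_add[OF assms, of "x - y" y] by simp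

lemma orth_proj_ident:
  assumes "subspace M" "x \<in> M"
  shows "orth_proj ip M x = x"
  by (rule orth_proj_eqI) (use assms in simp_all)

text \<open>The residual is orthogonal to \<open>orth_proj ip M x - z\<close>, which lies in
  \<open>M\<close>. Dropping the last term gives minimality of the distance; taking
  \<open>z = 0\<close> gives that the projection does not increase norms.\<close>

lemma orth_proj_pythagoras:
  assumes "subspace M" "closed M" "z \<in> M"
  shows "(norm (x - z))\<^sup>2 = (norm (x - orth_proj ip M x))\<^sup>2 + (norm (orth_proj ip M x - z))\<^sup>2"
proof -
  have "orth_proj ip M x - z \<in> M" by (intro subspace_diff orth_proj_in assms)
  from pythagoras[OF orth_proj_orthogonal[OF assms(1,2) this, of x]] show ?thesis by simp
qed

lemma orth_proj_nearest:
  assumes "subspace M" "closed M" "z \<in> M"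
  shows "norm (x - orth_proj ip M x) \<le> norm (x - z)"
  by (rule power2_le_imp_le) (use orth_proj_pythagoras[OF assms, of x] in simp_all)

lemma norm_orth_proj_le:
  assumes "subspace M" "closed M"
  shows "norm (orth_proj ip M x) \<le> norm x"
  by (rule power2_le_imp_le) (use orth_proj_pythagoras[OF assms subspace_0[OF assms(1)], of x] in simp_all)

section \<open>The gap between subspaces\<close>

text \<open>For a unit vector the residual is at most its infimal distance to \<open>L\<close>,
  which is one of the values under the supremum; the general case follows by scaling.\<close>

lemma norm_diff_orth_proj_le_gap:
  assumes K: "subspace K" and L: "subspace L" "closed L" and x: "x \<in> K"
  shows "norm (x - orth_proj ip L x) \<le> gap K L * norm x"
proof (cases "x = 0")
  case True
  then show ?thesis by (simp add: orth_proj_ident[OF L(1) subspace_0[OF L(1)]])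
next
  case False
  define u where "u = inverse (norm x) *\<^sub>R x"
  have u: "u \<in> K" "norm u = 1" using False by (simp_all add: u_def subspace_scaleR K x)
  have "L \<noteq> {}" using subspace_0[OF L(1)] by blast
  then have "norm (u - orth_proj ip L u) \<le> (INF y\<in>L. norm (u - y))"
    by (intro cINF_greatest orth_proj_nearest L)
  also have "\<dots> \<le> (SUP x\<in>{x\<in>K. norm x = 1}. INF y\<in>L. norm (x - y))"
  proof (rule cSUP_upper)
    \<comment> \<open>A real supremum is informative only over a bounded set. Choosing
      \<open>0\<close> in \<open>L\<close> bounds every infimum on the unit sphere by 1.\<close>
    have "(INF y\<in>L. norm (v - y)) \<le> norm (v - 0)" for v
      by (rule cINF_lower[OF _ subspace_0[OF L(1)]]) (auto intro: bdd_belowI[of _ 0])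
    then show "bdd_above ((\<lambda>x. INF y\<in>L. norm (x - y)) ` {x \<in> K. norm x = 1})"
      by (intro bdd_aboveI2[of _ _ 1]) (metis (mono_tags) diff_zero mem_Collect_eq)
  qed (use u in simp)
  also have "\<dots> = gap K L" using False x by (auto simp: gap_def)
  finally have *: "norm (u - orth_proj ip L u) \<le> gap K L" .
  have "u - orth_proj ip L u = inverse (norm x) *\<^sub>R (x - orth_proj ip L x)"
    using orth_proj_smul[OF L, of "of_real (inverse (norm x))" x]
    by (simp add: u_def smul_of_real scaleR_diff_right del: of_real_inverse)
  then have "norm (u - orth_proj ip L u) = norm (x - orth_proj ip L x) / norm x"
    by (simp add: divide_inverse)
  with * False show ?thesis by (simp add: divide_le_eq)
qed

lemma gap_nonneg:
  assumes K: "subspace K" and L: "subspace L" "closed L"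
  shows "0 \<le> gap K L"
proof (cases "K = {0}")
  case False
  then obtain x where "x \<in> K" "x \<noteq> 0" using subspace_0[OF K] by blast
  then show ?thesis
    using norm_diff_orth_proj_le_gap[OF K L \<open>x \<in> K\<close>] norm_ge_zero[of "x - orth_proj ip L x"]
    by (meson order_trans zero_le_mult_iff norm_le_zero_iff)
qed (simp add: gap_def)

section \<open>Perturbation of a frame and its dual expansion\<close>

text \<open>Write \<open>h k\<close> as \<open>f k - (f k - h k)\<close> and apply the triangle
  inequality in l^2: the coefficients against \<open>f\<close> contribute
  \<open>sqrt B * norm x\<close>, the errors \<open>sqrt lam * norm x\<close>. The estimate covers
  all \<open>x\<close> of the space.\<close>

lemma frame_perturbation_upper:
  assumes f: "frame_sequence smul ip f A B"
    and lam: "(\<lambda>k. (norm (f k - h k))\<^sup>2) sums lam"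
  shows "summable (\<lambda>k. (norm (ip x (h k)))\<^sup>2)"
    and "(\<Sum>k. (norm (ip x (h k)))\<^sup>2) \<le> (sqrt B * norm x + sqrt lam * norm x)\<^sup>2"
proof -
  let ?L = "closed_span smul f"
  note L = closed_subspace_closed_span[of f]
  \<comment> \<open>The upper frame bound of \<open>f\<close> is available on \<open>?L\<close>
    alone. Passing to \<open>p\<close> keeps all coefficients against \<open>f\<close> and does not
    increase the norm.\<close>
  define p where "p = orth_proj ip ?L x"
  have pL: "p \<in> ?L" by (simp add: p_def orth_proj_in L)
  have B: "0 < B" using f by (simp add: frame_sequence_def frame_for_def)
  have lam0: "0 \<le> lam" using sums_le[OF _ sums_zero lam] by simp
  have xf: "ip x (f k) = ip p (f k)" for k
    using orth_proj_orthogonal[OF L closed_span_base, of x k] by (simp add: p_def ip_diff_left)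
  have fp: "summable (\<lambda>k. (norm (ip p (f k)))\<^sup>2)" "(\<Sum>k. (norm (ip p (f k)))\<^sup>2) \<le> B * (norm p)\<^sup>2"
    using f pL by (auto simp: frame_sequence_def frame_for_def)
  have "B * (norm p)\<^sup>2 \<le> B * (norm x)\<^sup>2"
    using B norm_orth_proj_le[OF L, of x] by (intro mult_left_mono power_mono) (auto simp: p_def)
  then have "(\<Sum>k. (norm (ip p (f k)))\<^sup>2) \<le> B * (norm x)\<^sup>2" using fp(2) by linarith
  then have F: "summable (\<lambda>k. (norm (ip x (f k)))\<^sup>2)"
    "(\<Sum>k. (norm (ip x (f k)))\<^sup>2) \<le> (sqrt B * norm x)\<^sup>2"
    using fp(1) B by (simp_all add: xf power_mult_distrib)
  have dom: "(norm (ip x (f k - h k)))\<^sup>2 \<le> (norm x)\<^sup>2 * (norm (f k - h k))\<^sup>2" for k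
    using power_mono[OF Cauchy_Schwarz[of x "f k - h k"], of 2] by (simp add: power_mult_distrib)
  have major: "(\<lambda>k. (norm x)\<^sup>2 * (norm (f k - h k))\<^sup>2) sums ((norm x)\<^sup>2 * lam)"
    by (rule sums_mult[OF lam])
  have G: "summable (\<lambda>k. (norm (ip x (f k - h k)))\<^sup>2)"
    by (rule summable_comparison_test'[OF sums_summable[OF major]]) (use dom in simp)
  have "(\<Sum>k. (norm (ip x (f k - h k)))\<^sup>2) \<le> (norm x)\<^sup>2 * lam"
    by (rule sums_le[OF dom summable_sums[OF G] major])
  then have G': "(\<Sum>k. (norm (ip x (f k - h k)))\<^sup>2) \<le> (sqrt lam * norm x)\<^sup>2"
    using lam0 by (simp add: power_mult_distrib mult.commute)
  note tri = suminf_square_triangle[OF F(1) G F(2) G']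
  have le: "(norm (ip x (h k)))\<^sup>2 \<le> (norm (ip x (f k)) + norm (ip x (f k - h k)))\<^sup>2" for k
  proof (rule power_mono)
    have "ip x (h k) = ip x (f k) - ip x (f k - h k)" by (simp add: ip_diff_right)
    then show "norm (ip x (h k)) \<le> norm (ip x (f k)) + norm (ip x (f k - h k))"
      by (metis norm_triangle_ineq4)
  qed simp
  have tri1: "summable (\<lambda>k. (norm (ip x (f k)) + norm (ip x (f k - h k)))\<^sup>2)"
    by (rule tri(1)) (use B lam0 in simp_all)
  show sm: "summable (\<lambda>k. (norm (ip x (h k)))\<^sup>2)"
    by (rule summable_comparison_test'[OF tri1]) (use le in simp)
  have "(\<Sum>k. (norm (ip x (h k)))\<^sup>2) \<le> (\<Sum>k. (norm (ip x (f k)) + norm (ip x (f k - h k)))\<^sup>2)"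
    by (rule suminf_le[OF le sm tri1])
  also have "\<dots> \<le> (sqrt B * norm x + sqrt lam * norm x)\<^sup>2"
    by (rule tri(2)) (use B lam0 in simp_all)
  finally show "(\<Sum>k. (norm (ip x (h k)))\<^sup>2) \<le> (sqrt B * norm x + sqrt lam * norm x)\<^sup>2" .
qed

text \<open>The series for \<open>v\<close> converges as the reconstruction series of
  \<open>x\<close> minus an absolutely convergent error series, whose sum has norm at most
  \<open>mu * norm x\<close>.\<close>

lemma cross_expansion:
  assumes dual: "dual_frame_sequence smul ip f g C D"
    and mu: "(\<lambda>k. norm (f k - h k) * norm (g k)) sums mu"
    and x: "x \<in> closed_span smul f"
  obtains v where "(\<lambda>k. smul (ip x (g k)) (h k)) sums v" "norm (x - v) \<le> mu * norm x"
proof -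
  let ?e = "\<lambda>k. smul (ip x (g k)) (f k - h k)"
  have le: "norm (?e k) \<le> norm (f k - h k) * norm (g k) * norm x" for k
    using mult_right_mono[OF Cauchy_Schwarz[of x "g k"] norm_ge_zero[of "f k - h k"]]
    by (simp add: norm_smul mult_ac)
  have major: "(\<lambda>k. norm (f k - h k) * norm (g k) * norm x) sums (mu * norm x)"
    by (rule sums_mult2[OF mu])
  have sn: "summable (\<lambda>k. norm (?e k))"
    by (rule summable_comparison_test'[OF sums_summable[OF major]]) (use le in simp)
  have e: "?e sums suminf ?e" by (rule summable_sums[OF summable_norm_cancel[OF sn]])
  have f: "(\<lambda>k. smul (ip x (g k)) (f k)) sums x"
    using dual x by (simp add: dual_frame_sequence_def)
  have v: "(\<lambda>k. smul (ip x (g k)) (h k)) sums (x - suminf ?e)"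
    using sums_diff[OF f e] by (simp add: scale_right_diff_distrib)
  have "norm (suminf ?e) \<le> (\<Sum>k. norm (?e k))" by (rule summable_norm[OF sn])
  also have "\<dots> \<le> mu * norm x"
    by (rule sums_le[OF le summable_sums[OF sn] major])
  finally have "norm (x - (x - suminf ?e)) \<le> mu * norm x" by simp
  then show ?thesis using that v by blast
qed

text \<open>Projecting \<open>V x\<close> back to the closed span of \<open>f\<close> perturbs the
  identity there by a map of norm at most \<open>mu\<close>, below 1, so the equation for
  \<open>x\<close> is solvable by a contraction argument.\<close>

lemma cross_expansion_surj:
  assumes dual: "dual_frame_sequence smul ip f g C D"
    and mu: "(\<lambda>k. norm (f k - h k) * norm (g k)) sums mu" "mu < 1"
    and y: "y \<in> closed_span smul f"
  obtains x v where "x \<in> closed_span smul f" "(\<lambda>k. smul (ip x (g k)) (h k)) sums v"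
    "norm (x - v) \<le> mu * norm x" "orth_proj ip (closed_span smul f) v = y"
proof -
  let ?L = "closed_span smul f"
  note L = closed_subspace_closed_span[of f]
  let ?P = "orth_proj ip ?L"
  \<comment> \<open>Outside \<open>?L\<close> the series may diverge and \<open>V\<close> then has a
    default value; all uses stay inside \<open>?L\<close>.\<close>
  define V where "V x = (\<Sum>k. smul (ip x (g k)) (h k))" for x
  have V: "(\<lambda>k. smul (ip x (g k)) (h k)) sums V x" "norm (x - V x) \<le> mu * norm x"
    if "x \<in> ?L" for x
    using cross_expansion[OF dual mu(1) that] unfolding V_def by (metis sums_unique)+
  have V_diff: "V (x - z) = V x - V z" if "x \<in> ?L" "z \<in> ?L" for x z
    using sums_diff[OF V(1)[OF that(1)] V(1)[OF that(2)]]
    by (simp add: V_def ip_diff_left scale_left_diff_distrib sums_iff)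
  have mu0: "0 \<le> mu" using sums_le[OF _ sums_zero mu(1)] by simp
  \<comment> \<open>A fixed point of this map is exactly a solution of
    \<open>?P (V x) = y\<close>.\<close>
  have "\<exists>!x\<in>?L. y + x - ?P (V x) = x"
  proof (rule Banach_fix[of _ mu])
    show "complete ?L" using L(2) by (simp add: complete_eq_closed)
    show "?L \<noteq> {}" using y by blast
    show "(\<lambda>x. y + x - ?P (V x)) ` ?L \<subseteq> ?L"
      using y by (auto intro!: subspace_diff subspace_add orth_proj_in L)
    show "dist (y + x - ?P (V x)) (y + z - ?P (V z)) \<le> mu * dist x z" if xz: "x \<in> ?L" "z \<in> ?L" for x z
    proof -
      have d: "x - z \<in> ?L" using xz by (intro subspace_diff L)
      \<comment> \<open>Both \<open>x\<close> and \<open>z\<close> are fixed by \<open>?P\<close>,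
        so linearity collects everything into the error of the single vector
        \<open>x - z\<close>.\<close>
      have "(y + x - ?P (V x)) - (y + z - ?P (V z)) = ?P ((x - z) - V (x - z))"
        using xz by (simp add: V_diff orth_proj_diff[OF L] orth_proj_ident[OF L(1)])
      then have "dist (y + x - ?P (V x)) (y + z - ?P (V z)) \<le> norm ((x - z) - V (x - z))"
        by (simp only: dist_norm norm_orth_proj_le[OF L])
      also have "\<dots> \<le> mu * dist x z" using V(2)[OF d] by (simp add: dist_norm)
      finally show ?thesis .
    qed
  qed (use mu0 mu(2) in simp_all)
  then obtain x where "x \<in> ?L" "y + x - ?P (V x) = x" by blast
  then have "x \<in> ?L" "?P (V x) = y" by (simp_all add: algebra_simps)
  then show ?thesis using that V by blast
qed

text \<open>Pairing \<open>v\<close> with its own expansion and applying Cauchy-Schwarz brings in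
  the upper bound \<open>D\<close> of \<open>g\<close>, hence the factor \<open>1 / D\<close>; the
  remaining \<open>norm x\<close> is traded for \<open>norm v\<close> at the cost of
  \<open>1 - mu\<close>.\<close>

lemma synthesis_lower_bound:
  assumes dual: "dual_frame_sequence smul ip f g C D"
    and x: "x \<in> closed_span smul f"
    and v: "(\<lambda>k. smul (ip x (g k)) (h k)) sums v" "norm (x - v) \<le> mu * norm x" "mu < 1"
    and sm: "summable (\<lambda>k. (norm (ip v (h k)))\<^sup>2)"
  shows "1 / D * (1 - mu)\<^sup>2 * (norm v)\<^sup>2 \<le> (\<Sum>k. (norm (ip v (h k)))\<^sup>2)"
proof -
  define S where "S = (\<Sum>k. (norm (ip v (h k)))\<^sup>2)"
  have S0: "0 \<le> S" unfolding S_def by (rule suminf_nonneg[OF sm]) simp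
  have g: "0 < D" "summable (\<lambda>k. (norm (ip x (g k)))\<^sup>2)"
    "(\<Sum>k. (norm (ip x (g k)))\<^sup>2) \<le> D * (norm x)\<^sup>2"
    using dual x by (auto simp: dual_frame_sequence_def frame_for_def)
  \<comment> \<open>The expansion is inserted in the second, conjugate-linear slot, which is where
    the conjugated coefficients come from.\<close>
  have "(\<lambda>k. ip v (smul (ip x (g k)) (h k))) sums ip v v"
    by (rule bounded_linear.sums[OF bounded_bilinear.bounded_linear_right[OF bounded_bilinear_ip] v(1)])
  then have "(\<lambda>k. conjg (ip x (g k)) * ip v (h k)) sums ip v v"
    by (simp add: ip_smul_right)
  then have "norm (ip v v) \<le> sqrt (\<Sum>k. (norm (conjg (ip x (g k))))\<^sup>2) * sqrt S"
    unfolding S_def by (intro norm_sums_mult_le) (use g sm in simp_all)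
  then have "(norm v)\<^sup>2 \<le> sqrt (\<Sum>k. (norm (ip x (g k)))\<^sup>2) * sqrt S"
    by (simp add: ip_self norm_power)
  also have "\<dots> \<le> sqrt (D * (norm x)\<^sup>2) * sqrt S"
    using g S0 by (intro mult_right_mono real_sqrt_le_mono) auto
  finally have 1: "(norm v)\<^sup>2 \<le> sqrt D * norm x * sqrt S"
    by (simp add: real_sqrt_mult)
  have 2: "(1 - mu) * norm x \<le> norm v"
    using v(2) norm_triangle_ineq2[of x v] by (simp add: algebra_simps)
  have "(1 - mu) * (norm v)\<^sup>2 \<le> (1 - mu) * (sqrt D * norm x * sqrt S)"
    using 1 v(3) by (intro mult_left_mono) auto
  also have "\<dots> = ((1 - mu) * norm x) * (sqrt D * sqrt S)" by simp
  also have "\<dots> \<le> norm v * (sqrt D * sqrt S)"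
    using 2 g S0 by (intro mult_right_mono) auto
  finally have "norm v * ((1 - mu) * norm v) \<le> norm v * (sqrt D * sqrt S)"
    by (simp add: power2_eq_square mult_ac)
  \<comment> \<open>One factor \<open>norm v\<close> is cancelled, with \<open>v = 0\<close> treated
    separately.\<close>
  then have "(1 - mu) * norm v \<le> sqrt D * sqrt S"
    using mult_left_le_imp_le[of "norm v" "(1 - mu) * norm v"] g(1) S0 by (cases "v = 0") auto
  then have "((1 - mu) * norm v)\<^sup>2 \<le> (sqrt D * sqrt S)\<^sup>2"
    using v(3) by (intro power_mono) auto
  then have "(1 - mu)\<^sup>2 * (norm v)\<^sup>2 \<le> D * S"
    using g S0 by (simp add: power_mult_distrib)
  then show ?thesis using g(1) by (simp add: S_def divide_le_eq mult_ac)
qed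

section \<open>The projection restricted to \<open>K\<close>\<close>

text \<open>A gap below 1 bounds \<open>norm x\<close> on \<open>K\<close> by a multiple of the norm
  of its projection. This one estimate gives both injectivity and boundedness of the
  inverse.\<close>

lemma orth_proj_isomorphism_onI:
  assumes K: "subspace K" and L: "subspace L" "closed L"
    and gap: "gap K L < 1" and surj: "\<And>y. y \<in> L \<Longrightarrow> \<exists>x\<in>K. orth_proj ip L x = y"
  shows "inj_on (orth_proj ip L) K" "isomorphism_on smul K L (orth_proj ip L)"
proof -
  let ?P = "orth_proj ip L"
  have lower: "norm x \<le> 1 / (1 - gap K L) * norm (?P x)" if "x \<in> K" for x
  proof -
    have "norm x - norm (?P x) \<le> gap K L * norm x"
      using norm_diff_orth_proj_le_gap[OF K L that] norm_triangle_ineq2[of x "?P x"] by linarith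
    then show ?thesis using gap by (simp add: field_simps)
  qed
  show inj: "inj_on ?P K"
  proof (rule inj_onI)
    fix x y assume xy: "x \<in> K" "y \<in> K" "?P x = ?P y"
    then have "?P (x - y) = 0" by (simp add: orth_proj_diff[OF L])
    then show "x = y" using lower[of "x - y"] subspace_diff[OF K xy(1,2)] by simp
  qed
  have bij: "bij_betw ?P K L"
    unfolding bij_betw_def using inj surj orth_proj_in[OF L] by blast
  have "norm (inv_into K ?P y) \<le> 1 / (1 - gap K L) * norm y" if "y \<in> L" for y
    using lower[of "inv_into K ?P y"] bij that
    by (metis bij_betw_inv_into_right bij_betw_imp_surj_on inv_into_into)
  then show "isomorphism_on smul K L ?P"
    unfolding isomorphism_on_def
    using bij orth_proj_add[OF L] orth_proj_smul[OF L] norm_orth_proj_le[OF L]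
    by (metis mult_1)
qed

end

theorem theorem2p4:
  fixes smul :: "'k::hilbert_scalar \<Rightarrow> 'a::banach \<Rightarrow> 'a"
    and ip :: "'a \<Rightarrow> 'a \<Rightarrow> 'k"
    and f g h :: "nat \<Rightarrow> 'a"
    and A B C D lam mu :: real
    and K L :: "'a set"
  assumes "hilbert_space smul ip"
    and "frame_sequence smul ip f A B"
    and "dual_frame_sequence smul ip f g C D"
    and "K = closed_span smul h"
    and "L = closed_span smul f"
    and "gap K L < 1"
    and "(\<lambda>k. (norm (f k - h k))\<^sup>2) sums lam"
    and "(\<lambda>k. norm (f k - h k) * norm (g k)) sums mu"
    and "mu < 1"
  shows "frame_sequence smul ip h
           (1 / D * (1 - mu)\<^sup>2)
           (B * (1 + sqrt lam / sqrt B)\<^sup>2 * (1 / (1 - gap K L)\<^sup>2))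
         \<and> isomorphism_on smul K L (orth_proj ip L)"
proof -
  interpret hilbert_space smul ip by fact
  note K = closed_subspace_closed_span[of h, folded assms(4)]
  note L = closed_subspace_closed_span[of f, folded assms(5)]
  let ?P = "orth_proj ip L"
  define d where "d = gap K L"
  have B: "0 < B" and D: "0 < D"
    using assms(2,3) by (simp_all add: frame_sequence_def dual_frame_sequence_def frame_for_def)
  have lam: "0 \<le> lam" using sums_le[OF _ sums_zero assms(7)] by simp
  have d: "0 \<le> d" "d < 1" using gap_nonneg[OF K(1) L] assms(6) by (simp_all add: d_def)
  have ex: "\<exists>x v. x \<in> L \<and> v \<in> K \<and> (\<lambda>k. smul (ip x (g k)) (h k)) sums v
      \<and> norm (x - v) \<le> mu * norm x \<and> ?P v = y" if "y \<in> L" for y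
  proof -
    obtain x v where xv: "x \<in> L" "(\<lambda>k. smul (ip x (g k)) (h k)) sums v"
      "norm (x - v) \<le> mu * norm x" "?P v = y"
      using cross_expansion_surj[OF assms(3,8,9), folded assms(5)] \<open>y \<in> L\<close> by blast
    moreover have "v \<in> K" unfolding assms(4) by (rule sums_in_closed_span[OF xv(2)])
    ultimately show ?thesis by (intro exI conjI)
  qed
  have "\<exists>x\<in>K. ?P x = y" if "y \<in> L" for y using ex[OF that] by blast
  note iso = orth_proj_isomorphism_onI[OF K(1) L assms(6) this]
  note upper = frame_perturbation_upper[OF assms(2,7)]
  define b where "b = B * (1 + sqrt lam / sqrt B)\<^sup>2"
  \<comment> \<open>Rewrites the constant of the statement into the shape delivered by the l^2
    triangle inequality.\<close>
  have b: "b = (sqrt B + sqrt lam)\<^sup>2"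
  proof -
    have "sqrt B + sqrt lam = sqrt B * (1 + sqrt lam / sqrt B)"
      using B by (simp add: field_simps)
    then show ?thesis using B by (simp add: b_def power_mult_distrib)
  qed
  have b0: "0 < b" unfolding b using B lam by (intro zero_less_power add_pos_nonneg) simp_all
  have "(1 - d)\<^sup>2 \<le> 1" using d by (simp add: power_le_one)
  then have d1: "1 \<le> 1 / (1 - d)\<^sup>2" using d by simp
  have lo: "1 / D * (1 - mu)\<^sup>2 * (norm z)\<^sup>2 \<le> (\<Sum>k. (norm (ip z (h k)))\<^sup>2)" if z: "z \<in> K" for z
  proof -
    obtain x v where xv: "x \<in> L" "v \<in> K" "(\<lambda>k. smul (ip x (g k)) (h k)) sums v"
      "norm (x - v) \<le> mu * norm x" "?P v = ?P z"
      using ex[OF orth_proj_in[OF L]] by blast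
    \<comment> \<open>Both \<open>v\<close> and \<open>z\<close> lie in \<open>K\<close> and have
      the same projection, so injectivity identifies them. Thus every \<open>z\<close> in
      \<open>K\<close> has an expansion to which the lower estimate applies.\<close>
    then have "v = z" using iso(1) z by (auto dest: inj_onD)
    with xv show ?thesis
      using synthesis_lower_bound[OF assms(3) _ xv(3,4) assms(9) upper(1)] by (simp add: assms(5))
  qed
  have up: "(\<Sum>k. (norm (ip z (h k)))\<^sup>2) \<le> b * (1 / (1 - d)\<^sup>2) * (norm z)\<^sup>2" for z
  proof -
    have "(\<Sum>k. (norm (ip z (h k)))\<^sup>2) \<le> b * 1 * (norm z)\<^sup>2"
      using upper(2)[of z] by (simp add: b flip: power_mult_distrib distrib_right)
    \<comment> \<open>The gap factor is at least 1, so it only enlarges the right side.\<close>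
    also have "\<dots> \<le> b * (1 / (1 - d)\<^sup>2) * (norm z)\<^sup>2"
      using d1 b0 by (intro mult_right_mono mult_left_mono) auto
    finally show ?thesis .
  qed
  have "frame_for ip K h (1 / D * (1 - mu)\<^sup>2) (b * (1 / (1 - d)\<^sup>2))"
    unfolding frame_for_def
  proof (intro conjI ballI)
    show "0 < 1 / D * (1 - mu)\<^sup>2" using D assms(9) by simp
    show "0 < b * (1 / (1 - d)\<^sup>2)" using b0 d by simp
    show "range h \<subseteq> K" using closed_span_base[of h] assms(4) by auto
  qed (use upper(1) lo up in auto)
  then show ?thesis
    using iso(2) by (simp add: frame_sequence_def assms(4) b_def d_def)
qed

end
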